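(* For every $n\ge 1$, $$|\mathrm{Sym}_n(\xi)|=\sum_{t=0}^{n-1} t!\,(t+1)^{n-t-1}.$$
   Context: $\mathrm{Sym}_n$ is the set of permutations $\pi=\pi_1\cdots\pi_n$ of $\{1,\dots,n\}$ in one-line notation. $\xi=(132,\{0,2\},\emptyset)$ is a bivincular pattern: $\pi$ contains $\xi$ if there is an index $j\ge 2$ with $j+1\le n$ such that $\pi_1<\pi_{j+1}<\pi_j$ (that is, $\pi_1\pi_j\pi_{j+1}$ is an occurrence of $132$ starting at the first entry of $\pi$ and whose last two entries are adjacent in position); otherwise $\pi$ avoids $\xi$. $\mathrm{Sym}_n(\xi)$ is the set of permutations in $\mathrm{Sym}_n$ that avoid $\xi$. *)

theory Defs
  imports Complex_Main "HOL-Combinatorics.Multiset_Permutations"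
begin

text \<open>Permutations in one-line notation are lists; the paper's entries are indexed from 1,
  while list indexing with \<open>!\<close> starts at 0.\<close>

definition Sym :: "nat \<Rightarrow> nat list set" where
  "Sym n = permutations_of_set {1..n}"

definition entry :: "nat list \<Rightarrow> nat \<Rightarrow> nat" where
  "entry \<pi> i = \<pi> ! (i - 1)"

text \<open>Containment of the bivincular pattern \<open>\<xi> = (132, {0,2}, \<emptyset>)\<close>: the element 0 of \<open>{0,2}\<close> anchors
  an occurrence of 132 at the first entry, the element 2 makes its last two entries adjacent in
  position, and the empty set imposes no adjacency of values.\<close>

definition contains_xi :: "nat list \<Rightarrow> bool" where
  "contains_xi \<pi> \<longleftrightarrow>
     (\<exists>j. 2 \<le> j \<and> j + 1 \<le> length \<pi> \<and>
          entry \<pi> 1 < entry \<pi> (j + 1) \<and> entry \<pi> (j + 1) < entry \<pi> j)"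

definition Sym_xi :: "nat \<Rightarrow> nat list set" where
  "Sym_xi n = {\<pi> \<in> Sym n. \<not> contains_xi \<pi>}"

end

theory Submission
  imports Defs
begin

text \<open>Fix the first entry \<open>k\<close> and call the entries below \<open>k\<close> small and those above it big. Avoiding \<open>\<xi>\<close> means
  that, after the first entry, every descent ends in a small entry. If the big entries are inserted in increasing
  order, each new maximum may be placed exactly at the end or directly in front of a small entry.
  With \<open>t = k - 1\<close> small entries this gives \<open>t!\<close> arrangements of the small entries and \<open>t + 1\<close> choices for each
  of the \<open>n - t - 1\<close> big ones.\<close>

text \<open>The set \<open>S\<close> is a parameter separate from \<open>A\<close>, so that it stays
  fixed while \<open>A\<close> grows by one maximum at a time.\<close>

definition descents_into :: "'a::linorder set \<Rightarrow> 'a set \<Rightarrow> 'a list set" where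
  "descents_into S A = {xs \<in> permutations_of_set A. successively (\<lambda>x y. x < y \<or> y \<in> S) xs}"

text \<open>These are the admissible slots for a new maximum; \<open>vs = []\<close> is the slot at
  the end.\<close>

definition splits_before :: "'a set \<Rightarrow> 'a list \<Rightarrow> ('a list \<times> 'a list) set" where
  "splits_before S ys = {(us, vs). us @ vs = ys \<and> (vs = [] \<or> hd vs \<in> S)}"

lemma splits_before_Cons:
  "splits_before S (a # ys) =
     (if a \<in> S then {([], a # ys)} else {}) \<union> (\<lambda>(us, vs). (a # us, vs)) ` splits_before S ys"
  by (auto simp: splits_before_def append_eq_Cons_conv image_iff)

text \<open>Prepending \<open>a\<close> lengthens the first part of every old split and adds one
  split with empty first part exactly when \<open>a\<close> is in \<open>S\<close>. Distinctness
  ensures that \<open>a\<close> was not counted before; the successor is the slot at the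
  end.\<close>

lemma card_splits_before:
  assumes "distinct ys"
  shows "finite (splits_before S ys) \<and> card (splits_before S ys) = Suc (card (S \<inter> set ys))"
  using assms
proof (induction ys)
  case Nil
  have "splits_before S [] = {([], [])}"
    by (auto simp: splits_before_def)
  then show ?case by simp
next
  case (Cons a ys)
  have "inj_on (\<lambda>(us, vs). (a # us, vs)) (splits_before S ys)"
    by (auto simp: inj_on_def)
  then have "card ((\<lambda>(us, vs). (a # us, vs)) ` splits_before S ys) = Suc (card (S \<inter> set ys))"
    using Cons by (simp add: card_image)
  moreover have "([], a # ys) \<notin> (\<lambda>(us, vs). (a # us, vs)) ` splits_before S ys"
    by auto
  ultimately show ?case
    using Cons by (simp add: splits_before_Cons)
qed

lemma finite_descents_into: "finite A \<Longrightarrow> finite (descents_into S A)"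
  by (simp add: descents_into_def)

lemma descents_into_self: "descents_into S S = permutations_of_set S"
proof -
  have "successively (\<lambda>x y. x < y \<or> y \<in> S) xs" if "set xs = S" for xs
    using that by (auto simp: successively_conv_nth)
  then show ?thesis
    by (auto simp: descents_into_def permutations_of_set_def)
qed

text \<open>The step into \<open>m\<close> is an ascent and the step out of it a descent, so only
  \<open>hd vs\<close> is constrained. Conversely, deleting \<open>m\<close> makes
  \<open>last us\<close> and \<open>hd vs\<close> adjacent, which is harmless because
  \<open>hd vs\<close> lies in \<open>S\<close>.\<close>

lemma insert_max_descents_into_iff:
  assumes "\<forall>a\<in>A. a < m" "S \<subseteq> A"
  shows "us @ m # vs \<in> descents_into S (insert m A) \<longleftrightarrow>
         us @ vs \<in> descents_into S A \<and> (vs = [] \<or> hd vs \<in> S)"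
proof -
  have "m \<notin> A" using assms by auto
  then have perm: "us @ m # vs \<in> permutations_of_set (insert m A) \<longleftrightarrow>
                   us @ vs \<in> permutations_of_set A"
    by (auto simp: permutations_of_set_def)
  have "successively (\<lambda>x y. x < y \<or> y \<in> S) (us @ m # vs) \<longleftrightarrow>
        successively (\<lambda>x y. x < y \<or> y \<in> S) (us @ vs) \<and> (vs = [] \<or> hd vs \<in> S)"
    if "us @ vs \<in> permutations_of_set A"
  proof -
    have set: "set us \<union> set vs = A"
      using that by (auto simp: permutations_of_set_def)
    have "us = [] \<or> last us < m"
      using set assms by (metis UnCI last_in_set)
    moreover have "vs = [] \<or> \<not> m < hd vs"
      using set assms by (metis UnCI hd_in_set not_less_iff_gr_or_eq)
    ultimately show ?thesis
      by (auto simp: successively_append_iff successively_Cons)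
  qed
  with perm show ?thesis by (auto simp: descents_into_def)
qed

lemma card_descents_into_insert_max:
  assumes "finite A" "\<forall>a\<in>A. a < m" "S \<subseteq> A"
  shows "card (descents_into S (insert m A)) = Suc (card S) * card (descents_into S A)"
proof -
  let ?P = "\<Union>ys\<in>descents_into S A. splits_before S ys"
  have m: "m \<notin> A" using assms by auto
  have perm: "distinct ys" "set ys = A" if "ys \<in> descents_into S A" for ys
    using that by (auto simp: descents_into_def permutations_of_set_def)
  have "descents_into S (insert m A) = (\<lambda>(us, vs). us @ m # vs) ` ?P"
  proof (intro equalityI subsetI)
    fix xs assume xs: "xs \<in> descents_into S (insert m A)"
    then have "m \<in> set xs"
      by (auto simp: descents_into_def permutations_of_set_def)
    then obtain us vs where "xs = us @ m # vs"
      by (meson split_list)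
    with xs show "xs \<in> (\<lambda>(us, vs). us @ m # vs) ` ?P"
      using insert_max_descents_into_iff[OF assms(2,3)]
      by (auto simp: splits_before_def image_iff)
  next
    fix xs assume "xs \<in> (\<lambda>(us, vs). us @ m # vs) ` ?P"
    then show "xs \<in> descents_into S (insert m A)"
      using insert_max_descents_into_iff[OF assms(2,3)]
      by (auto simp: splits_before_def)
  qed
  \<comment> \<open>The single occurrence of \<open>m\<close> marks where to cut, so the list
    determines the split.\<close>
  moreover have "inj_on (\<lambda>(us, vs). us @ m # vs) ?P"
  proof -
    have "m \<notin> set us \<and> m \<notin> set vs" if "(us, vs) \<in> ?P" for us vs
      using that perm m by (fastforce simp: splits_before_def)
    then show ?thesis
      by (intro inj_onI) (metis (no_types, lifting) append_Cons_eq_iff case_prod_conv surj_pair)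
  qed
  ultimately have "card (descents_into S (insert m A)) = card ?P"
    by (simp add: card_image)
  also have "\<dots> = (\<Sum>ys\<in>descents_into S A. card (splits_before S ys))"
  \<comment> \<open>The slot sets are disjoint because \<open>us @ vs\<close> recovers
    \<open>ys\<close>.\<close>
  proof (rule card_UN_disjoint)
    show "finite (descents_into S A)"
      using assms(1) by (rule finite_descents_into)
    show "\<forall>ys\<in>descents_into S A. finite (splits_before S ys)"
      using perm card_splits_before by blast
  qed (auto simp: splits_before_def)
  also have "\<dots> = (\<Sum>ys\<in>descents_into S A. Suc (card S))"
  proof (rule sum.cong[OF refl])
    fix ys assume "ys \<in> descents_into S A"
    then show "card (splits_before S ys) = Suc (card S)"
      using card_splits_before[of ys S] perm assms(3) by (simp add: Int_absorb2)
  qed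
  finally show ?thesis by simp
qed

text \<open>Induction from the least element of \<open>B\<close> upwards: each inserted element
  exceeds all of \<open>S\<close> and the earlier part of \<open>B\<close>, and contributes one
  factor. In the base case every step ends in \<open>S\<close>, so all permutations of
  \<open>S\<close> count.\<close>

lemma card_descents_into:
  assumes "finite B" "finite S" "\<forall>s\<in>S. \<forall>b\<in>B. s < b"
  shows "card (descents_into S (S \<union> B)) = fact (card S) * (card S + 1) ^ card B"
  using assms(1,3)
proof (induction B rule: finite_linorder_max_induct)
  case empty
  then show ?case
    using assms(2) by (simp add: descents_into_self)
next
  case (insert m B)
  then have "card (descents_into S (insert m (S \<union> B))) =
             Suc (card S) * card (descents_into S (S \<union> B))"
    using assms(2) by (intro card_descents_into_insert_max) auto
  moreover have "m \<notin> B" using insert by auto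
  ultimately show ?case
    using insert by (simp add: algebra_simps)
qed

lemma contains_xi_Cons:
  assumes "k # xs \<in> Sym n"
  shows "contains_xi (k # xs) \<longleftrightarrow> \<not> successively (\<lambda>x y. x < y \<or> y \<in> {1..<k}) xs"
proof -
  have xs: "distinct xs" "k \<notin> set xs" and "set xs \<subseteq> {1..n}"
    using assms by (auto simp: Sym_def permutations_of_set_def)
  then have pos: "xs ! i \<ge> 1" if "i < length xs" for i
    using that nth_mem by fastforce
  have "contains_xi (k # xs) \<longleftrightarrow>
        (\<exists>i. Suc i < length xs \<and> k < xs ! Suc i \<and> xs ! Suc i < xs ! i)"
  proof
    assume "contains_xi (k # xs)"
    then obtain j where j: "2 \<le> j" "j + 1 \<le> length (k # xs)"
      "k < (k # xs) ! j" "(k # xs) ! j < (k # xs) ! (j - 1)"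
      by (auto simp: contains_xi_def entry_def)
    \<comment> \<open>Two shifts add up here: entries count from 1, and \<open>k\<close> precedes
      \<open>xs\<close>. Thus entry \<open>j\<close> of \<open>k # xs\<close> is
      \<open>xs ! (j - 2)\<close>.\<close>
    obtain i where "j = Suc (Suc i)"
      using j(1) by (metis One_nat_def Suc_1 Suc_le_D Suc_le_mono)
    with j show "\<exists>i. Suc i < length xs \<and> k < xs ! Suc i \<and> xs ! Suc i < xs ! i"
      by (auto simp: Suc_le_eq)
  next
    assume "\<exists>i. Suc i < length xs \<and> k < xs ! Suc i \<and> xs ! Suc i < xs ! i"
    then obtain i where "Suc i < length xs" "k < xs ! Suc i" "xs ! Suc i < xs ! i"
      by blast
    then show "contains_xi (k # xs)"
      unfolding contains_xi_def entry_def by (intro exI[of _ "i + 2"]) simp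
  qed
  \<comment> \<open>Since no entry of \<open>xs\<close> equals \<open>k\<close> and neighbours
    differ, both negated conditions become strict inequalities; positivity of the entries supplies
    the lower bound of \<open>{1..<k}\<close>.\<close>
  moreover have "k < xs ! Suc i \<and> xs ! Suc i < xs ! i \<longleftrightarrow>
        \<not> (xs ! i < xs ! Suc i \<or> xs ! Suc i \<in> {1..<k})" if "Suc i < length xs" for i
  proof -
    have "xs ! Suc i \<noteq> k" using xs(2) that nth_mem by blast
    moreover have "xs ! i \<noteq> xs ! Suc i"
      using xs(1) that by (simp add: nth_eq_iff_index_eq)
    ultimately show ?thesis using pos[OF that] by auto
  qed
  ultimately show ?thesis
    unfolding successively_conv_nth by blast
qed

lemma Sym_xi_eq_UN:
  assumes "n \<ge> 1"
  shows "Sym_xi n = (\<Union>k\<in>{1..n}. (#) k ` descents_into {1..<k} ({1..<k} \<union> {k<..n}))"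
proof -
  have Sym: "Sym n = (\<Union>k\<in>{1..n}. (#) k ` permutations_of_set ({1..n} - {k}))"
    using assms unfolding Sym_def by (intro permutations_of_set_nonempty) auto
  have "{1..n} - {k} = {1..<k} \<union> {k<..n}" if "k \<in> {1..n}" for k
    using that by auto
  with Sym have Sym: "Sym n = (\<Union>k\<in>{1..n}. (#) k ` permutations_of_set ({1..<k} \<union> {k<..n}))"
    by simp
  then have "Sym_xi n =
      (\<Union>k\<in>{1..n}. {\<pi> \<in> (#) k ` permutations_of_set ({1..<k} \<union> {k<..n}). \<not> contains_xi \<pi>})"
    by (auto simp: Sym_xi_def)
  also have "\<dots> = (\<Union>k\<in>{1..n}. (#) k ` descents_into {1..<k} ({1..<k} \<union> {k<..n}))"
  proof (rule SUP_cong[OF refl])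
    fix k assume k: "k \<in> {1..n}"
    have "contains_xi (k # xs) \<longleftrightarrow> \<not> successively (\<lambda>x y. x < y \<or> y \<in> {1..<k}) xs"
      if "xs \<in> permutations_of_set ({1..<k} \<union> {k<..n})" for xs
      using that k Sym by (intro contains_xi_Cons[of _ _ n]) blast
    then show "{\<pi> \<in> (#) k ` permutations_of_set ({1..<k} \<union> {k<..n}). \<not> contains_xi \<pi>} =
               (#) k ` descents_into {1..<k} ({1..<k} \<union> {k<..n})"
      unfolding descents_into_def by auto
  qed
  finally show ?thesis .
qed

theorem theorem5:
  fixes n :: nat
  assumes "n \<ge> 1"
  shows "card (Sym_xi n) = (\<Sum>t = 0..n - 1. fact t * (t + 1) ^ (n - t - 1))"
proof -
  let ?D = "\<lambda>k. descents_into {1..<k} ({1..<k} \<union> {k<..n})"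
  have "card (Sym_xi n) = (\<Sum>k\<in>{1..n}. card ((#) k ` ?D k))"
    unfolding Sym_xi_eq_UN[OF assms]
    \<comment> \<open>Lists with different first entries are different, hence the union is
      disjoint.\<close>
    by (intro card_UN_disjoint) (auto simp: finite_descents_into)
  also have "\<dots> = (\<Sum>k\<in>{1..n}. fact (k - 1) * k ^ (n - k))"
  proof (rule sum.cong[OF refl])
    fix k assume "k \<in> {1..n}"
    moreover have "card (?D k) = fact (card {1..<k}) * (card {1..<k} + 1) ^ card {k<..n}"
      by (rule card_descents_into) auto
    ultimately show "card ((#) k ` ?D k) = fact (k - 1) * k ^ (n - k)"
      by (simp add: card_image)
  qed
  also have "\<dots> = (\<Sum>t = 0..n - 1. fact t * (t + 1) ^ (n - t - 1))"
    \<comment> \<open>The new index \<open>t = k - 1\<close> is the number of entries below the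
      first one.\<close>
    using assms by (intro sum.reindex_bij_witness[of _ "\<lambda>t. t + 1" "\<lambda>k. k - 1"]) auto
  finally show ?thesis .
qed

end
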